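(* Let $\gamma\ge0$, $p,N\in\mathbb{R}$ and let $n\ge0$ be an integer such that one of the following holds: (i) $p<0$ and $N-\gamma<0$; (ii) $0<p<1$ and $n\in\{0,1,\dots,\lfloor N-\gamma\rfloor\}$; (iii) $p>1$ and $N-\gamma<0$. Then, as polynomials in $x$, $$\mathscr{K}_n(x;p,N,\gamma)=\left(\frac{p-1}{p}\right)^{n}\frac{(\gamma+1)_n}{n!}\sum_{k=0}^{n}(1-p)^{-k}\frac{(-n)_k(\gamma-N+x)_k}{(\gamma+1)_k(\gamma-N)_k}\;{}_4F_3\left(\begin{array}{c}k-n,\ \gamma-N+x+k,\ \gamma-N-1,\ \gamma\\ \gamma-N+x,\ \gamma-N+k,\ \gamma+1+k\end{array}\Big|\,1\right).$$
   Context: The associated Krawtchouk polynomials $\mathscr{K}_n(x;p,N,\gamma)$ are defined by $\mathscr{K}_{-1}=0$, $\mathscr{K}_0=1$ and $$p(N-n-\gamma)\,\mathscr{K}_{n+1}(x;p,N,\gamma)=[pN+(n+\gamma)(1-2p)-x]\,\mathscr{K}_n(x;p,N,\gamma)-(n+\gamma)(1-p)\,\mathscr{K}_{n-1}(x;p,N,\gamma)$$ for $n\ge0$ as long as $N-n-\gamma\neq0$. $\lfloor\cdot\rfloor$ is the floor function. Pochhammer symbol: $(b)_0=1$, $(b)_k=b(b+1)\cdots(b+k-1)$. The terminating series is ${}_4F_3\left(\begin{array}{c}k-n,a_2,a_3,a_4\\ b_1,b_2,b_3\end{array}\Big|1\right)=\sum_{j=0}^{n-k}\frac{(k-n)_j(a_2)_j(a_3)_j(a_4)_j}{(b_1)_j(b_2)_j(b_3)_j\,j!}$.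 Convention: the factor $(\gamma-N+x)_k(\gamma-N+x+k)_j/(\gamma-N+x)_j$ in each term is a polynomial in $x$ (equal to $(\gamma-N+x+j)_k$), so at the finitely many $x$ where $(\gamma-N+x)_j$ vanishes the right-hand side is understood by continuity in $x$. *)

theory Defs
  imports Complex_Main "HOL-Computational_Algebra.Polynomial"
begin

(* The recurrence solved for its leading term, with the value 0 standing for index -1.
   Only indices reached without meeting N - n - \<gamma> = 0 (and with p nonzero) are meaningful:
   past such an index the division by zero yields junk. *)
fun assoc_krawtchouk :: "real \<Rightarrow> real \<Rightarrow> real \<Rightarrow> nat \<Rightarrow> real poly" where
  "assoc_krawtchouk p N \<gamma> 0 = 1"
| "assoc_krawtchouk p N \<gamma> (Suc n) =
     smult (1 / (p * (N - real n - \<gamma>)))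
       ([:p * N + (real n + \<gamma>) * (1 - 2 * p), -1:] * assoc_krawtchouk p N \<gamma> n
        - smult ((real n + \<gamma>) * (1 - p))
            (case n of 0 \<Rightarrow> 0 | Suc m \<Rightarrow> assoc_krawtchouk p N \<gamma> m))"

lemma assoc_krawtchouk_recurrence:
  assumes "p \<noteq> 0" "N - real n - \<gamma> \<noteq> 0"
  shows "p * (N - real n - \<gamma>) * poly (assoc_krawtchouk p N \<gamma> (Suc n)) x =
           (p * N + (real n + \<gamma>) * (1 - 2 * p) - x) * poly (assoc_krawtchouk p N \<gamma> n) x
           - (real n + \<gamma>) * (1 - p) *
             (if n = 0 then 0 else poly (assoc_krawtchouk p N \<gamma> (n - 1)) x)"
proof -
  have cancel: "c * (1 / c * a) = a" if "c \<noteq> 0" for a c :: real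
    using that by simp
  have "p * (N - real n - \<gamma>) \<noteq> 0"
    using assms by simp
  then show ?thesis
    unfolding assoc_krawtchouk.simps(2) poly_smult by (subst cancel) (auto split: nat.split simp: algebra_simps)
qed

(* Terminating 4F3 at unit argument whose first numerator parameter is -m. *)
definition hyp4F3_terminating ::
  "nat \<Rightarrow> real \<Rightarrow> real \<Rightarrow> real \<Rightarrow> real \<Rightarrow> real \<Rightarrow> real \<Rightarrow> real" where
  "hyp4F3_terminating m a2 a3 a4 b1 b2 b3 =
     (\<Sum>j=0..m. (pochhammer (- real m) j * pochhammer a2 j * pochhammer a3 j * pochhammer a4 j)
              / (pochhammer b1 j * pochhammer b2 j * pochhammer b3 j * fact j))"

end

theory Submission
  imports Defs
begin

text \<open>
  Put \<open>M = \<gamma> - N\<close>, \<open>q = 1 - p\<close>, \<open>y = M + x\<close>. Collecting the terms of the double series with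
  \<open>j + k = m\<close> turns the right-hand side into \<open>(- q / p)\<^sup>n\<close> times the single sum of
  \<open>a n m * c m\<close> over \<open>m \<le> n\<close>, where only \<open>c m\<close> depends on \<open>q\<close> and \<open>y\<close>. Now \<open>c\<close> satisfies the first-order
  recurrence \<open>q * c (m + 1) = (y + m) * c m + q * d (m + 1)\<close>, so multiplication by \<open>y\<close> acts on the
  sum as an index shift. Comparing coefficients of \<open>c m\<close>, the three-term recurrence in \<open>n\<close> reduces to rational
  identities for \<open>a\<close>, except for the boundary term at \<open>m = 0\<close>, which is cancelled by the
  inhomogeneity \<open>d\<close>.
\<close>

section \<open>Weights, source terms and inner sums of the single-sum form\<close>

definition kraw_weight :: "real \<Rightarrow> real \<Rightarrow> nat \<Rightarrow> nat \<Rightarrow> real" where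
  "kraw_weight g M n m =
     pochhammer (g + 1) n * pochhammer (- real n) m
       / (fact n * pochhammer (g + 1) m * pochhammer M m)"

definition kraw_source :: "real \<Rightarrow> real \<Rightarrow> nat \<Rightarrow> real" where
  "kraw_source g M j = pochhammer (M - 1) j * pochhammer g j / fact j"

text \<open>With \<open>k = m - j\<close>, \<open>pochhammer (y + real j) k\<close> is the
  continuous form of \<open>pochhammer y k * pochhammer (y + real k) j / pochhammer y j\<close>, so
  there is no division by an expression in \<open>y\<close>.\<close>

definition kraw_inner :: "real \<Rightarrow> real \<Rightarrow> real \<Rightarrow> real \<Rightarrow> nat \<Rightarrow> real" where
  "kraw_inner q y g M m =
     (\<Sum>j\<le>m. pochhammer (y + real j) (m - j) / q ^ (m - j) * kraw_source g M j)"

definition kraw_sum :: "real \<Rightarrow> real \<Rightarrow> real \<Rightarrow> real \<Rightarrow> nat \<Rightarrow> real" where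
  "kraw_sum q y g M n = (\<Sum>m\<le>n. kraw_weight g M n m * kraw_inner q y g M m)"

lemma kraw_inner_0 [simp]: "kraw_inner q y g M 0 = 1"
  by (simp add: kraw_inner_def kraw_source_def)

text \<open>Every old term gains the same factor, since
  \<open>(y + real j) + real (m - j) = y + real m\<close>; the source is the new term
  \<open>j = Suc m\<close>.\<close>

lemma kraw_inner_Suc:
  assumes "q \<noteq> 0"
  shows "kraw_inner q y g M (Suc m) =
           (y + real m) / q * kraw_inner q y g M m + kraw_source g M (Suc m)"
proof -
  have "(\<Sum>j\<le>m. pochhammer (y + real j) (Suc m - j) / q ^ (Suc m - j) * kraw_source g M j)
      = (\<Sum>j\<le>m. (y + real m) / q *
           (pochhammer (y + real j) (m - j) / q ^ (m - j) * kraw_source g M j))"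
    by (intro sum.cong refl) (auto simp: Suc_diff_le pochhammer_rec' of_nat_diff)
  then show ?thesis
    by (simp add: kraw_inner_def sum_distrib_left)
qed

section \<open>Contiguous relations for the weights\<close>

text \<open>Peel off either the first or the last factor of
  \<open>pochhammer (- real (Suc n)) (Suc m)\<close>.\<close>

lemma pochhammer_minus_of_nat_Suc:
  "(real m - real (Suc n)) * pochhammer (- real (Suc n)) m
     = - real (Suc n) * pochhammer (- real n) m"
  using pochhammer_rec[of "- real (Suc n)" m] pochhammer_rec'[of "- real (Suc n)" m]
  by (simp add: algebra_simps)

lemma kraw_weight_diff_mult:
  "(real (Suc n) - real m) * kraw_weight g M (Suc n) m
     = (real (Suc n) + g) * kraw_weight g M n m"
proof -
  have *: "(real (Suc n) - real m) * pochhammer (- real (Suc n)) m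
      = real (Suc n) * pochhammer (- real n) m"
    using pochhammer_minus_of_nat_Suc[of m n] by (simp add: algebra_simps)
  have "(real (Suc n) - real m) * kraw_weight g M (Suc n) m
      = pochhammer (g + 1) (Suc n) * ((real (Suc n) - real m) * pochhammer (- real (Suc n)) m)
        / (fact (Suc n) * pochhammer (g + 1) m * pochhammer M m)"
    by (simp add: kraw_weight_def)
  also have "\<dots> = (real (Suc n) * (real (Suc n) + g) * (pochhammer (g + 1) n * pochhammer (- real n) m))
        / (real (Suc n) * (fact n * pochhammer (g + 1) m * pochhammer M m))"
    unfolding * pochhammer_rec' fact_Suc by (simp add: algebra_simps)
  also have "\<dots> = (real (Suc n) + g) * kraw_weight g M n m"
    by (simp add: kraw_weight_def del: of_nat_Suc)
  finally show ?thesis .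
qed

lemma kraw_weight_eq_0: "n < m \<Longrightarrow> kraw_weight g M n m = 0"
  by (simp add: kraw_weight_def pochhammer_of_nat_eq_0_iff)

lemma kraw_weight_Suc_right:
  assumes "g \<ge> 0" "pochhammer M (Suc m) \<noteq> 0"
  shows "(g + 1 + real m) * (M + real m) * kraw_weight g M n (Suc m)
           = (real m - real n) * kraw_weight g M n m"
proof -
  have "g + 1 + real m \<noteq> 0" "M + real m \<noteq> 0"
    using assms by (auto simp: pochhammer_rec')
  moreover have "a * b * (u * (w * z) / (f * (a * v) * (b * t))) = w * (u * z / (f * v * t))"
    if "a \<noteq> 0" "b \<noteq> 0" for a b u w z f v t :: real
    using that by (simp add: field_simps)
  ultimately show ?thesis
    by (simp add: kraw_weight_def pochhammer_rec')
qed

lemma kraw_weight_Suc_Suc: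
  assumes "g \<ge> 0" "pochhammer M (Suc m) \<noteq> 0"
  shows "(g + 1 + real m) * (M + real m) * kraw_weight g M (Suc n) (Suc m)
           = - ((g + 1 + real n) * kraw_weight g M n m)"
proof -
  have "pochhammer (- real (Suc n)) (Suc m) = - real (Suc n) * pochhammer (- real n) m"
    by (simp add: pochhammer_rec)
  moreover have "g + 1 + real m \<noteq> 0" "M + real m \<noteq> 0"
    using assms by (auto simp: pochhammer_rec')
  moreover have "a * b * (u * w * (- s * z) / (s * f * (a * v) * (b * t))) = - (w * (u * z / (f * v * t)))"
    if "a \<noteq> 0" "b \<noteq> 0" "s \<noteq> 0" for a b u w s z f v t :: real
    using that by (simp add: field_simps)
  ultimately show ?thesis
    by (simp add: kraw_weight_def pochhammer_rec'[of "g + 1"] pochhammer_rec'[of M] fact_Suc mult_ac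
        del: of_nat_Suc)
qed

text \<open>The left side is the coefficient of \<open>c (m + 1)\<close> in the recurrence.
  Multiplied by \<open>?D\<close>, each term is a multiple of \<open>kraw_weight g M n m\<close>,
  and a polynomial identity remains.\<close>

lemma kraw_weight_shift:
  assumes "g \<ge> 0" "pochhammer M (Suc m) \<noteq> 0"
  shows "(M + real n) * kraw_weight g M (Suc n) (Suc m)
           - (M + real n + g + real (Suc m)) * kraw_weight g M n (Suc m)
           + kraw_weight g M n m = 0" (is "?l = 0")
proof -
  let ?D = "(g + 1 + real m) * (M + real m)"
  have D: "?D \<noteq> 0"
    using assms by (auto simp: pochhammer_rec')
  have "?D * ?l = (M + real n) * (?D * kraw_weight g M (Suc n) (Suc m))
           - (M + real n + g + real (Suc m)) * (?D * kraw_weight g M n (Suc m))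
           + ?D * kraw_weight g M n m"
    by (simp add: algebra_simps)
  also have "\<dots> = 0"
    unfolding kraw_weight_Suc_right[OF assms, of n] kraw_weight_Suc_Suc[OF assms, of n]
    by (simp add: algebra_simps)
  finally show ?thesis
    using D by simp
qed

section \<open>The boundary term at \<open>m = 0\<close>\<close>

text \<open>Telescoping: as \<open>(z + real m) - real (Suc m) = z - 1\<close>, each summand times
  \<open>z - 1\<close> is an increment of \<open>pochhammer z m / fact m\<close>.\<close>

lemma sum_pochhammer_over_fact_Suc:
  fixes z :: real
  shows "(z - 1) * (\<Sum>m<k. pochhammer z m / fact (Suc m)) = pochhammer z k / fact k - 1"
proof (induction k)
  case (Suc k)
  have "pochhammer z k / fact k = real (Suc k) * pochhammer z k / fact (Suc k)"
    by (simp del: of_nat_Suc)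
  then have "(z - 1) * (pochhammer z k / fact (Suc k)) + pochhammer z k / fact k
      = pochhammer z (Suc k) / fact (Suc k)"
    by (simp add: pochhammer_rec' add_divide_distrib[symmetric] algebra_simps del: fact_Suc)
  then show ?case
    using Suc by (simp add: distrib_left del: fact_Suc)
qed simp

lemma kraw_source_Suc:
  "kraw_source g M (Suc m) = (M - 1) * g * (pochhammer M m * pochhammer (g + 1) m) / fact (Suc m)"
  by (simp add: kraw_source_def pochhammer_rec mult_ac)

text \<open>The source cancels the Pochhammer denominators of the weight. What remains telescopes
  with \<open>z = - real n\<close>, and \<open>pochhammer (- real n) (Suc n) = 0\<close> removes the
  upper end.\<close>

lemma sum_kraw_weight_source:
  assumes "g \<ge> 0" "pochhammer M (Suc n) \<noteq> 0"
  shows "(\<Sum>m\<le>n. kraw_weight g M n m * kraw_source g M (Suc m))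
           = (M - 1) * g / real (Suc n) * kraw_weight g M n 0"
proof -
  have "kraw_weight g M n m * kraw_source g M (Suc m)
      = (M - 1) * g * (pochhammer (g + 1) n / fact n) * (pochhammer (- real n) m / fact (Suc m))"
    if "m \<le> n" for m
  proof -
    have "pochhammer M m \<noteq> 0" "pochhammer (g + 1) m \<noteq> 0"
      using assms that by (auto simp: pochhammer_eq_0_iff)
    then show ?thesis
      by (simp add: kraw_weight_def kraw_source_Suc del: fact_Suc)
  qed
  then have "(\<Sum>m\<le>n. kraw_weight g M n m * kraw_source g M (Suc m))
      = (M - 1) * g * (pochhammer (g + 1) n / fact n)
          * (\<Sum>m\<le>n. pochhammer (- real n) m / fact (Suc m))"
    by (simp add: sum_distrib_left del: fact_Suc)
  also have "(\<Sum>m\<le>n. pochhammer (- real n) m / fact (Suc m)) = 1 / real (Suc n)"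
  proof -
    have "pochhammer (- real n) (Suc n) = 0"
      by (simp add: pochhammer_of_nat_eq_0_iff)
    then have "- real (Suc n) * (\<Sum>m\<le>n. pochhammer (- real n) m / fact (Suc m)) = - 1"
      using sum_pochhammer_over_fact_Suc[of "- real n" "Suc n"]
      by (simp add: lessThan_Suc_atMost algebra_simps del: fact_Suc sum.atMost_Suc)
    then show ?thesis
      by (simp add: eq_divide_eq mult.commute del: fact_Suc of_nat_Suc)
  qed
  finally show ?thesis
    by (simp add: kraw_weight_def)
qed

text \<open>Counterpart of \<open>kraw_weight_shift\<close> at index 0, where the last summand is
  missing; the defect is the sum from \<open>sum_kraw_weight_source\<close>.\<close>

lemma kraw_weight_shift_0:
  "(M + real n) * kraw_weight g M (Suc n) 0 - (M + real n + g) * kraw_weight g M n 0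
     = (M - 1) * g / real (Suc n) * kraw_weight g M n 0"
proof -
  have "kraw_weight g M (Suc n) 0 = (g + real (Suc n)) / real (Suc n) * kraw_weight g M n 0"
    by (simp add: kraw_weight_def pochhammer_rec' add_ac)
  then show ?thesis
    by (simp add: field_simps)
qed

section \<open>The three-term recurrence of the single sum\<close>

text \<open>The factor \<open>real n - real m\<close> kills the top term and lowers \<open>n\<close>
  in the others; this is how index \<open>n - 1\<close> enters the recurrence.\<close>

lemma kraw_sum_diff_mult:
  "(\<Sum>m\<le>n. (real n - real m) * kraw_weight g M n m * kraw_inner q y g M m)
     = (if n = 0 then 0 else (real n + g) * kraw_sum q y g M (n - 1))"
proof (cases n)
  case (Suc k)
  have "(\<Sum>m\<le>Suc k. (real (Suc k) - real m) * kraw_weight g M (Suc k) m * kraw_inner q y g M m)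
      = (\<Sum>m\<le>k. (real (Suc k) + g) * kraw_weight g M k m * kraw_inner q y g M m)"
    unfolding kraw_weight_diff_mult by (simp add: kraw_weight_eq_0)
  then show ?thesis
    by (simp add: Suc kraw_sum_def sum_distrib_left mult_ac del: of_nat_Suc sum.atMost_Suc)
qed simp

text \<open>The defining recurrence of the polynomials, freed of the power of
  \<open>(p - 1) / p\<close>, with \<open>q = 1 - p\<close>, \<open>M = \<gamma> - N\<close> and
  \<open>y = M + x\<close>.\<close>

lemma kraw_sum_recurrence:
  assumes "q \<noteq> 0" "g \<ge> 0" "pochhammer M (Suc n) \<noteq> 0"
  shows "q * (M + real n) * kraw_sum q y g M (Suc n) =
           (q * (M + 2 * real n + g) - real n - y) * kraw_sum q y g M n
           + (1 - q) * (if n = 0 then 0 else (real n + g) * kraw_sum q y g M (n - 1))"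
proof -
  let ?a = "kraw_weight g M" and ?c = "kraw_inner q y g M" and ?d = "kraw_source g M"
  have nz: "pochhammer M (Suc m) \<noteq> 0" if "m \<le> n" for m
    using assms(3) that by (auto simp: pochhammer_eq_0_iff)
  have y: "y * ?c m = q * ?c (Suc m) - q * ?d (Suc m) - real m * ?c m" for m
    using assms(1) by (simp add: kraw_inner_Suc field_simps)
  have "y * kraw_sum q y g M n = (\<Sum>m\<le>n. ?a n m * (y * ?c m))"
    by (simp add: kraw_sum_def sum_distrib_left mult_ac)
  also have "\<dots> = q * (\<Sum>m\<le>n. ?a n m * ?c (Suc m)) - q * (\<Sum>m\<le>n. ?a n m * ?d (Suc m))
        - (\<Sum>m\<le>n. real m * ?a n m * ?c m)"
    unfolding y by (simp add: sum_distrib_left sum_subtractf[symmetric] algebra_simps)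
  finally have yS: "y * kraw_sum q y g M n =
      q * (\<Sum>m\<le>n. ?a n m * ?c (Suc m)) - q * (\<Sum>m\<le>n. ?a n m * ?d (Suc m))
        - (\<Sum>m\<le>n. real m * ?a n m * ?c m)" .
  \<comment> \<open>All sums are to run over \<open>?c (Suc m)\<close>; because
    \<open>?a n (Suc n) = 0\<close>, the upper limit can stay at \<open>n\<close>.\<close>
  have split0: "(\<Sum>m\<le>n. f m) = f 0 + (\<Sum>m\<le>n. f (Suc m))" if "f (Suc n) = 0" for f :: "nat \<Rightarrow> real"
    using that sum.atMost_Suc_shift[of f n] by simp
  have S1: "kraw_sum q y g M (Suc n) = ?a (Suc n) 0 + (\<Sum>m\<le>n. ?a (Suc n) (Suc m) * ?c (Suc m))"
    unfolding kraw_sum_def sum.atMost_Suc_shift by simp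
  have S0: "kraw_sum q y g M n = ?a n 0 + (\<Sum>m\<le>n. ?a n (Suc m) * ?c (Suc m))"
    unfolding kraw_sum_def by (subst split0) (simp_all add: kraw_weight_eq_0)
  have W: "(\<Sum>m\<le>n. real m * ?a n m * ?c m) = (\<Sum>m\<le>n. real (Suc m) * ?a n (Suc m) * ?c (Suc m))"
    by (subst split0) (simp_all add: kraw_weight_eq_0)
  have "(\<Sum>m\<le>n. ((M + real n) * ?a (Suc n) (Suc m)
           - (M + real n + g + real (Suc m)) * ?a n (Suc m) + ?a n m) * ?c (Suc m)) = 0"
    using kraw_weight_shift[OF assms(2) nz] by (intro sum.neutral) auto
  then have "(M + real n) * (\<Sum>m\<le>n. ?a (Suc n) (Suc m) * ?c (Suc m))
      - (M + real n + g) * (\<Sum>m\<le>n. ?a n (Suc m) * ?c (Suc m))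
      - (\<Sum>m\<le>n. real (Suc m) * ?a n (Suc m) * ?c (Suc m))
      + (\<Sum>m\<le>n. ?a n m * ?c (Suc m)) = 0"
    by (simp add: sum_distrib_left sum_subtractf[symmetric] sum.distrib[symmetric] algebra_simps
        del: of_nat_Suc)
  moreover have "(M + real n) * ?a (Suc n) 0 - (M + real n + g) * ?a n 0
      = (\<Sum>m\<le>n. ?a n m * ?d (Suc m))"
    using sum_kraw_weight_source[OF assms(2,3)] kraw_weight_shift_0[of M n g] by simp
  ultimately have main: "(M + real n) * kraw_sum q y g M (Suc n) - (M + real n + g) * kraw_sum q y g M n
      - (\<Sum>m\<le>n. real m * ?a n m * ?c m) + (\<Sum>m\<le>n. ?a n m * ?c (Suc m))
      - (\<Sum>m\<le>n. ?a n m * ?d (Suc m)) = 0"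
    unfolding S1 S0 W by (simp add: algebra_simps)
  \<comment> \<open>By \<open>kraw_sum_diff_mult\<close> the left side is the \<open>n - 1\<close>
    term of the goal, which is thus expressed through sums at level \<open>n\<close>.\<close>
  have T: "(\<Sum>m\<le>n. (real n - real m) * ?a n m * ?c m)
      = real n * kraw_sum q y g M n - (\<Sum>m\<le>n. real m * ?a n m * ?c m)"
    by (simp add: kraw_sum_def sum_distrib_left sum_subtractf[symmetric] algebra_simps)
  define u where "u = (\<Sum>m\<le>n. ?a n m * ?c (Suc m))"
  define v where "v = (\<Sum>m\<le>n. ?a n m * ?d (Suc m))"
  define w where "w = (\<Sum>m\<le>n. real m * ?a n m * ?c m)"
  have "q * ((M + real n) * kraw_sum q y g M (Suc n) - (M + real n + g) * kraw_sum q y g M n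
      - w + u - v) = 0"
    using main by (simp add: u_def v_def w_def)
  moreover have "y * kraw_sum q y g M n = q * u - q * v - w"
    using yS by (simp add: u_def v_def w_def)
  ultimately show ?thesis
    unfolding kraw_sum_diff_mult[symmetric] T w_def[symmetric] by (simp add: algebra_simps)
qed

section \<open>Identification with the polynomials\<close>

text \<open>Both sides obey the same recurrence. The Pochhammer hypothesis says that no step below
  \<open>n\<close> divides by zero.\<close>

lemma poly_assoc_krawtchouk:
  assumes "p \<noteq> 0" "p \<noteq> 1" "\<gamma> \<ge> 0" "pochhammer (\<gamma> - N) n \<noteq> 0"
  shows "poly (assoc_krawtchouk p N \<gamma> n) x =
           ((p - 1) / p) ^ n * kraw_sum (1 - p) (\<gamma> - N + x) \<gamma> (\<gamma> - N) n"
  using assms(4)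
proof (induction n rule: less_induct)
  case (less n)
  show ?case
  proof (cases n)
    case 0
    then show ?thesis
      by (simp add: kraw_sum_def kraw_weight_def)
  next
    case (Suc m)
    let ?M = "\<gamma> - N" and ?r = "(p - 1) / p"
    let ?S = "kraw_sum (1 - p) (?M + x) \<gamma> ?M" and ?K = "\<lambda>n. poly (assoc_krawtchouk p N \<gamma> n) x"
    have nz: "pochhammer ?M k \<noteq> 0" if "k \<le> n" for k
      using less.prems that by (auto simp: pochhammer_eq_0_iff)
    have Mm: "?M + real m \<noteq> 0"
      using nz[of "Suc m"] Suc by (auto simp: pochhammer_rec')
    have IHm: "?K m = ?r ^ m * ?S m"
      using less.IH[of m] nz[of m] Suc by simp
    define T where "T = (if m = 0 then 0 else (real m + \<gamma>) * ?S (m - 1))"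
    \<comment> \<open>The extra factor \<open>?r\<close> lifts \<open>?r ^ (m - 1)\<close> to
      \<open>?r ^ m\<close>; the recurrence supplies it through
      \<open>p - 1 = p * ?r\<close>.\<close>
    have IHp: "(if m = 0 then 0 else ?K (m - 1)) * (real m + \<gamma>) * ?r = ?r ^ m * T"
    proof (cases m)
      case (Suc k)
      then show ?thesis
        using less.IH[of k] nz[of k] \<open>n = Suc m\<close> by (simp add: T_def)
    qed (simp add: T_def)
    have rec: "(1 - p) * (?M + real m) * ?S (Suc m) =
        ((1 - p) * (?M + 2 * real m + \<gamma>) - real m - (?M + x)) * ?S m + p * T"
      using kraw_sum_recurrence[of "1 - p" \<gamma> ?M m "?M + x"] assms nz[of "Suc m"] Suc
      by (simp add: T_def)
    have pr: "p * ?r = p - 1"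
      using assms by simp
    have IHp': "X * (real m + \<gamma>) * (p - 1) = p * (X * (real m + \<gamma>) * ?r)" for X
    proof -
      have "p * (X * (real m + \<gamma>) * ?r) = X * (real m + \<gamma>) * (p * ?r)"
        by (simp only: mult_ac)
      then show ?thesis
        by (simp only: pr)
    qed
    have "p * (N - real m - \<gamma>) * ?K (Suc m) =
       (p * N + (real m + \<gamma>) * (1 - 2 * p) - x) * ?K m
       + (if m = 0 then 0 else ?K (m - 1)) * (real m + \<gamma>) * (p - 1)"
      using assoc_krawtchouk_recurrence[of p N m \<gamma> x] assms(1) Mm
      by (simp add: algebra_simps del: assoc_krawtchouk.simps)
    also have "\<dots> = ?r ^ m * ((p * N + (real m + \<gamma>) * (1 - 2 * p) - x) * ?S m + p * T)"
      unfolding IHm IHp' IHp by (simp add: algebra_simps)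
    also have "\<dots> = ?r ^ m * ((1 - p) * (?M + real m) * ?S (Suc m))"
      unfolding rec by (simp add: algebra_simps)
    also have "\<dots> = ?r ^ m * ((p * ?r) * (N - real m - \<gamma>) * ?S (Suc m))"
      unfolding pr by (simp add: algebra_simps)
    also have "\<dots> = p * (N - real m - \<gamma>) * (?r ^ Suc m * ?S (Suc m))"
      by (simp only: power_Suc mult_ac)
    finally show ?thesis
      using assms(1) Mm Suc by (subst (asm) mult_left_cancel) auto
  qed
qed

section \<open>Regrouping the double series\<close>

text \<open>Pochhammer symbols with shifts \<open>k\<close> and \<open>j\<close> merge into index
  \<open>j + k\<close>, and the quotient in \<open>y\<close> becomes
  \<open>pochhammer (y + real j) k\<close>; then sum along \<open>j + k = m\<close>.\<close>

lemma hyp4F3_double_sum_eq_kraw_sum: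
  assumes y: "pochhammer y n \<noteq> 0" and M: "pochhammer M n \<noteq> 0" and g: "g \<ge> 0"
  shows "pochhammer (g + 1) n / fact n *
      (\<Sum>k=0..n. q powi (- int k) *
         ((pochhammer (- real n) k * pochhammer y k) / (pochhammer (g + 1) k * pochhammer M k)) *
         hyp4F3_terminating (n - k) (y + real k) (M - 1) g y (M + real k) (g + 1 + real k))
    = kraw_sum q y g M n" (is "?P * (\<Sum>k=0..n. ?A k * ?H k) = _")
proof -
  define F where "F = (\<lambda>j k. kraw_weight g M n (j + k)
    * (pochhammer (y + real j) k / q ^ k * kraw_source g M j))"
  have "?P * (?A k * ?H k) = (\<Sum>j\<le>n - k. F j k)" if k: "k \<le> n" for k
  proof -
    have "?P * (?A k * ((pochhammer (- real (n - k)) j * pochhammer (y + real k) j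
            * pochhammer (M - 1) j * pochhammer g j)
          / (pochhammer y j * pochhammer (M + real k) j * pochhammer (g + 1 + real k) j * fact j)))
        = F j k" if j: "j \<le> n - k" for j
    proof -
      have "pochhammer y j \<noteq> 0"
        using y j by (auto simp: pochhammer_eq_0_iff)
      moreover have "pochhammer y k * pochhammer (y + real k) j
          = pochhammer y j * pochhammer (y + real j) k"
        by (metis add.commute pochhammer_product')
      moreover have "pochhammer (- real n) (j + k)
          = pochhammer (- real n) k * pochhammer (- real (n - k)) j"
        using k by (simp add: add.commute[of j] pochhammer_product' of_nat_diff)
      moreover have "pochhammer z (j + k) = pochhammer z k * pochhammer (z + real k) j" for z :: real
        by (simp add: add.commute[of j] pochhammer_product')
      ultimately have
        "pochhammer (y + real j) k = pochhammer y k * pochhammer (y + real k) j / pochhammer y j"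
        "pochhammer (- real n) (j + k) = pochhammer (- real n) k * pochhammer (- real (n - k)) j"
        "pochhammer M (j + k) = pochhammer M k * pochhammer (M + real k) j"
        "pochhammer (g + 1) (j + k) = pochhammer (g + 1) k * pochhammer (g + 1 + real k) j"
        by (auto simp: field_simps)
      then show ?thesis
        by (simp add: F_def kraw_weight_def kraw_source_def power_int_minus divide_inverse mult_ac)
    qed
    then show ?thesis
      unfolding hyp4F3_terminating_def sum_distrib_left atMost_atLeast0 by (intro sum.cong refl) auto
  qed
  then have "?P * (\<Sum>k=0..n. ?A k * ?H k) = (\<Sum>k\<le>n. \<Sum>j\<le>n - k. F j k)"
    unfolding sum_distrib_left atMost_atLeast0 by (intro sum.cong refl) auto
  also have "\<dots> = (\<Sum>(k, j)\<in>{(k, j). k + j \<le> n}. F j k)"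
    by (subst sum.Sigma) (auto intro!: sum.cong)
  \<comment> \<open>\<open>sum.triangle_reindex_eq\<close> keeps the first coordinate as inner
    index, and \<open>kraw_inner\<close> sums over \<open>j\<close>.\<close>
  also have "\<dots> = (\<Sum>(j, k)\<in>{(j, k). j + k \<le> n}. F j k)"
    by (rule sum.reindex_bij_witness[of _ "\<lambda>(a, b). (b, a)" "\<lambda>(a, b). (b, a)"]) auto
  also have "\<dots> = kraw_sum q y g M n"
    unfolding sum.triangle_reindex_eq kraw_sum_def kraw_inner_def F_def sum_distrib_left
    by (intro sum.cong refl) auto
  finally show ?thesis .
qed

section \<open>Removable singularities and conclusion\<close>

lemma eventually_pochhammer_shift_neq_0:
  fixes c :: real
  shows "eventually (\<lambda>x. pochhammer (c + x) n \<noteq> 0) (at a)"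
proof -
  let ?Z = "(\<lambda>k. - c - real k) ` {..<n}"
  \<comment> \<open>Taking \<open>a\<close> out of the finite zero set makes the complement a
    neighbourhood of \<open>a\<close> even if \<open>a\<close> is a zero.\<close>
  have "open (- (?Z - {a}))"
    by (intro open_Compl finite_imp_closed) simp
  moreover have "pochhammer (c + x) n \<noteq> 0" if "x \<in> - (?Z - {a})" "x \<noteq> a" for x
    using that by (force simp: pochhammer_eq_0_iff image_iff)
  ultimately show ?thesis
    unfolding eventually_at_topological by (intro exI[of _ "- (?Z - {a})"]) auto
qed

(* The right-hand side R has removable singularities where pochhammer (\<gamma> - N + x) n vanishes;
   as a division by zero its value there is junk, so there the identity is stated via the limit. *)
theorem mainTheorem11:
  fixes \<gamma> p N :: real and n :: nat
  assumes "\<gamma> \<ge> 0"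
    and "(p < 0 \<and> N - \<gamma> < 0)
       \<or> (0 < p \<and> p < 1 \<and> int n \<in> {0..\<lfloor>N - \<gamma>\<rfloor>})
       \<or> (p > 1 \<and> N - \<gamma> < 0)"
  shows
    "let R = (\<lambda>x::real.
           ((p - 1) / p) ^ n * (pochhammer (\<gamma> + 1) n / fact n) *
           (\<Sum>k=0..n. (1 - p) powi (- int k) *
              ((pochhammer (- real n) k * pochhammer (\<gamma> - N + x) k)
               / (pochhammer (\<gamma> + 1) k * pochhammer (\<gamma> - N) k)) *
              hyp4F3_terminating (n - k) (\<gamma> - N + x + real k) (\<gamma> - N - 1) \<gamma>
                (\<gamma> - N + x) (\<gamma> - N + real k) (\<gamma> + 1 + real k)))
     in (\<forall>x. pochhammer (\<gamma> - N + x) n \<noteq> 0 \<longrightarrow> poly (assoc_krawtchouk p N \<gamma> n) x = R x)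
      \<and> (\<forall>x. (R \<longlongrightarrow> poly (assoc_krawtchouk p N \<gamma> n) x) (at x))"
proof -
  have p: "p \<noteq> 0" "p \<noteq> 1"
    using assms(2) by auto
  \<comment> \<open>These factors are positive if \<open>N - \<gamma> < 0\<close>; otherwise
    \<open>k < n \<le> N - \<gamma>\<close> makes them negative.\<close>
  have "\<gamma> - N + real k \<noteq> 0" if "k < n" for k
  proof (cases "N - \<gamma> < 0")
    case False
    then have "int n \<le> \<lfloor>N - \<gamma>\<rfloor>"
      using assms(2) by auto
    then have "real n \<le> N - \<gamma>"
      by (simp add: le_floor_iff)
    then show ?thesis
      using that by linarith
  qed simp
  then have M: "pochhammer (\<gamma> - N) n \<noteq> 0"
    by (force simp: pochhammer_eq_0_iff)
  define R where "R = (\<lambda>x::real.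
           ((p - 1) / p) ^ n * (pochhammer (\<gamma> + 1) n / fact n) *
           (\<Sum>k=0..n. (1 - p) powi (- int k) *
              ((pochhammer (- real n) k * pochhammer (\<gamma> - N + x) k)
               / (pochhammer (\<gamma> + 1) k * pochhammer (\<gamma> - N) k)) *
              hyp4F3_terminating (n - k) (\<gamma> - N + x + real k) (\<gamma> - N - 1) \<gamma>
                (\<gamma> - N + x) (\<gamma> - N + real k) (\<gamma> + 1 + real k)))"
  have eq: "poly (assoc_krawtchouk p N \<gamma> n) x = R x" if "pochhammer (\<gamma> - N + x) n \<noteq> 0" for x
    unfolding poly_assoc_krawtchouk[OF p assms(1) M]
      hyp4F3_double_sum_eq_kraw_sum[OF that M assms(1), symmetric] R_def
    by (simp only: mult.assoc)
  \<comment> \<open>\<open>R\<close> agrees with a continuous function on a punctured neighbourhood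
    of \<open>a\<close>.\<close>
  have "(R \<longlongrightarrow> poly (assoc_krawtchouk p N \<gamma> n) a) (at a)" for a
  proof (rule Lim_transform_eventually)
    show "(poly (assoc_krawtchouk p N \<gamma> n) \<longlongrightarrow> poly (assoc_krawtchouk p N \<gamma> n) a) (at a)"
      using poly_isCont[of a] by (simp add: isCont_def)
    show "eventually (\<lambda>x. poly (assoc_krawtchouk p N \<gamma> n) x = R x) (at a)"
      using eventually_pochhammer_shift_neq_0[of "\<gamma> - N" n a] by (rule eventually_mono) (rule eq)
  qed
  with eq show ?thesis
    unfolding R_def Let_def by blast
qed

end
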